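(* Let $\{A_n\}_{n\ge0}$ be an even sequence, and let $l\ge1$ be an integer such that $A_0=A_1=\cdots=A_{l-1}=0$ and $A_l\neq0$. Then the sequence $$\Big\{\frac{A_{n+l}}{(n+1)(n+2)\cdots(n+l)}\Big\}_{n\ge0}$$ is an even sequence.
   Context: A sequence $\{a_n\}_{n\ge0}$ of real (or complex) numbers is called an even sequence if $\sum_{k=0}^n\binom nk(-1)^ka_k=a_n$ for all $n=0,1,2,\ldots$. *)

theory Defs
  imports Complex_Main
begin

(* The class field_char_0 has both real and complex as instances, so one definition
   serves for real and for complex sequences. *)
definition even_seq :: "(nat \<Rightarrow> 'a::field_char_0) \<Rightarrow> bool" where
  "even_seq a \<longleftrightarrow> (\<forall>n. (\<Sum>k=0..n. of_nat (n choose k) * (-1) ^ k * a k) = a n)"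

end

theory Submission
  imports Defs
begin

text \<open>Write P(n) = (n+1)...(n+l) = (n+l)!/n!. By \<open>binomial_div_prod\<close>, dividing (n
  choose k) by P(k) gives (n+l choose k+l) divided by P(n), and P(n) does not depend on k. The
  alternating sum at n for the new sequence is therefore, up to the factor (-1)^l, the one for
  \<open>A\<close> at n+l divided by P(n): the first l terms of the latter vanish. The factor is 1,
  since evenness of \<open>A\<close> at index l together with \<open>A l \<noteq> 0\<close> forces l
  to be even.\<close>

lemma prod_shift_fact:
  "(\<Prod>j=1..l. of_nat (n + j)) = (fact (n + l) / fact n :: 'a::field_char_0)"
proof (induction l)
  case (Suc l)
  have "(\<Prod>j=1..Suc l. of_nat (n + j)) = (\<Prod>j=1..l. of_nat (n + j)) * (of_nat (Suc (n + l)) :: 'a)"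
    by simp
  then show ?case
    unfolding Suc.IH by simp
qed simp

text \<open>In factorials, both sides equal n! / ((n-k)! (k+l)!).\<close>

lemma binomial_div_prod:
  assumes "k \<le> n"
  shows "of_nat (n choose k) / (\<Prod>j=1..l. of_nat (k + j)) =
    (of_nat ((n + l) choose (k + l)) / (\<Prod>j=1..l. of_nat (n + j)) :: 'a::field_char_0)"
  unfolding prod_shift_fact using assms by (simp add: binomial_fact)

theorem theorem2p8:
  fixes A :: "nat \<Rightarrow> 'a::field_char_0" and l :: nat
  assumes "even_seq A"
    and "l \<ge> 1"
    and "\<And>i. i < l \<Longrightarrow> A i = 0"
    and "A l \<noteq> 0"
  shows "even_seq (\<lambda>n. A (n + l) / (\<Prod>j=1..l. of_nat (n + j)))"
proof -
  have sum_A: "(\<Sum>k=0..n. of_nat ((n + l) choose (k + l)) * (-1) ^ (k + l) * A (k + l)) = A (n + l)"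
    for n
  proof -
    have "(\<Sum>k=0..n. of_nat ((n + l) choose (k + l)) * (-1) ^ (k + l) * A (k + l)) =
        (\<Sum>k=l..n + l. of_nat ((n + l) choose k) * (-1) ^ k * A k)"
      using sum.shift_bounds_cl_nat_ivl
          [of "\<lambda>k. of_nat ((n + l) choose k) * (-1) ^ k * A k" 0 l n]
      by simp
    \<comment> \<open>The added indices k < l contribute nothing because \<open>A\<close> vanishes
      there; the sum is now the full one for \<open>A\<close> at n+l.\<close>
    also have "\<dots> = (\<Sum>k=0..n + l. of_nat ((n + l) choose k) * (-1) ^ k * A k)"
      by (rule sum.mono_neutral_left) (auto simp: assms(3))
    finally show ?thesis
      using assms(1) by (simp add: even_seq_def)
  qed
  \<comment> \<open>The evenness relation at index \<open>l\<close> reads \<open>(-1) ^ l * A l = A l\<close>.\<close>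
  have sign: "(-1) ^ l = (1 :: 'a)"
    using sum_A[of 0] assms(4) by simp
  have "(\<Sum>k=0..n. of_nat (n choose k) * (-1) ^ k * (A (k + l) / (\<Prod>j=1..l. of_nat (k + j)))) =
      A (n + l) / (\<Prod>j=1..l. of_nat (n + j))" for n
  proof -
    have "(\<Sum>k=0..n. of_nat (n choose k) * (-1) ^ k * (A (k + l) / (\<Prod>j=1..l. of_nat (k + j)))) =
        (\<Sum>k=0..n. of_nat (n choose k) / (\<Prod>j=1..l. of_nat (k + j)) * (-1) ^ k * A (k + l))"
      by simp
    also have "\<dots> = (\<Sum>k=0..n. of_nat ((n + l) choose (k + l)) / (\<Prod>j=1..l. of_nat (n + j)) *
        (-1) ^ k * A (k + l))"
      by (intro sum.cong refl) (simp only: binomial_div_prod atLeastAtMost_iff)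
    \<comment> \<open>By \<open>sign\<close>, (-1)^k may be replaced by (-1)^(k+l), which matches
      the form of \<open>sum_A\<close>.\<close>
    also have "\<dots> = (\<Sum>k=0..n. of_nat ((n + l) choose (k + l)) * (-1) ^ (k + l) * A (k + l)) /
        (\<Prod>j=1..l. of_nat (n + j))"
      by (simp add: sum_divide_distrib power_add sign)
    finally show ?thesis
      by (simp only: sum_A)
  qed
  then show ?thesis
    by (simp add: even_seq_def)
qed

end
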